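(* For any positive integer $n$, \[ \sum_{S\subseteq\{0,\dots,n-1\}}|S+S| = 2^n(2n-11)+\begin{cases}19\cdot 3^{(n-1)/2}, & n\text{ odd},\\ 11\cdot 3^{n/2}, & n\text{ even}.\end{cases} \]
   Context: $S+S=\{s_1+s_2: s_1,s_2\in S\}$; the sum runs over all $2^n$ subsets $S$, including the empty set (for which $|S+S|=0$). *)

theory Defs
  imports Main "HOL-Library.Set_Algebras"
begin

end

theory Submission
  imports Defs
begin

text \<open>
  Exchanging the order of summation, one counts for each $k \le 2n-2$ the sets $S$ with
  $k \notin S+S$. The pairs $\{x, k-x\}$ inside the interval behave independently: each admits
  three of its four subsets, the fixed point $x = k/2$ must be omitted, and every $x$ with $k-x$
  outside the interval is free. If $m$ elements $x$ have their partner $k-x$ in the interval,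
  the count is therefore $2^{n-m} 3^{\lfloor m/2\rfloor}$. Here $m = k+1$ for $k < n$ and
  $m = 2n-1-k$ for $k \ge n$, which leaves a geometric-type sum.
\<close>

definition sum_avoiders :: "nat set \<Rightarrow> nat \<Rightarrow> nat set set" where
  "sum_avoiders A k = {S. S \<subseteq> A \<and> k \<notin> S + S}"

lemma mem_sum_avoiders:
  "S \<in> sum_avoiders A k \<longleftrightarrow> S \<subseteq> A \<and> (\<forall>x\<in>S. \<forall>y\<in>S. x + y \<noteq> k)"
  unfolding sum_avoiders_def set_plus_def by blast

lemma finite_sum_avoiders: "finite A \<Longrightarrow> finite (sum_avoiders A k)"
  by (rule finite_subset[of _ "Pow A"]) (auto simp: sum_avoiders_def)

lemma inj_on_insert_sum_avoiders: "x \<notin> A \<Longrightarrow> inj_on (insert x) (sum_avoiders A k)"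
  by (rule inj_onI) (metis mem_sum_avoiders insert_ident subsetD)

text \<open>Membership of \<open>x\<close> is a free binary choice: adding or deleting it never
  creates or destroys a sum equal to \<open>k\<close>. The case \<open>y = x\<close> of
  \<open>free\<close> excludes \<open>x + x = k\<close>.\<close>

lemma card_sum_avoiders_insert_free:
  assumes "finite A" "x \<notin> A" and free: "\<And>y. y \<in> insert x A \<Longrightarrow> x + y \<noteq> k"
  shows "card (sum_avoiders (insert x A) k) = 2 * card (sum_avoiders A k)"
proof -
  let ?F = "sum_avoiders A k"
  have "sum_avoiders (insert x A) k = ?F \<union> insert x ` ?F"
  proof (intro set_eqI iffI)
    fix S assume S: "S \<in> sum_avoiders (insert x A) k"
    then have "S - {x} \<in> ?F" by (auto simp: mem_sum_avoiders)
    moreover have "S = S - {x} \<or> S = insert x (S - {x})" by blast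
    ultimately show "S \<in> ?F \<union> insert x ` ?F" by (metis UnI1 UnI2 imageI)
  next
    fix S assume "S \<in> ?F \<union> insert x ` ?F"
    then show "S \<in> sum_avoiders (insert x A) k"
    proof
      assume "S \<in> insert x ` ?F"
      then obtain T where T: "T \<in> ?F" "S = insert x T" by blast
      then show ?thesis
        using free by (fastforce simp: mem_sum_avoiders add.commute)
    qed (auto simp: mem_sum_avoiders)
  qed
  moreover have "?F \<inter> insert x ` ?F = {}"
    using assms(2) by (auto simp: mem_sum_avoiders)
  ultimately show ?thesis
    using assms(1,2)
    by (simp add: card_Un_disjoint finite_sum_avoiders card_image inj_on_insert_sum_avoiders)
qed

text \<open>Avoiders are sorted by their trace on \<open>{x, y}\<close>: empty, \<open>{x}\<close>
  or \<open>{y}\<close>. The trace puts no constraint on the rest, since the only partner of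
  \<open>x\<close> is \<open>y\<close> and conversely; \<open>x \<noteq> y\<close> keeps both
  doubles different from \<open>k\<close>.\<close>

lemma card_sum_avoiders_insert_pair:
  assumes "finite A" "x \<notin> A" "y \<notin> A" "x \<noteq> y" "x + y = k"
  shows "card (sum_avoiders (insert x (insert y A)) k) = 3 * card (sum_avoiders A k)"
proof -
  let ?F = "sum_avoiders A k"
  have insert_mem: "insert u T \<in> sum_avoiders (insert x (insert y A)) k"
    if "T \<in> ?F" "u = x \<or> u = y" for u T
    using that assms(2-5) unfolding mem_sum_avoiders
    by (smt (verit) add.commute add_left_cancel insert_iff subset_iff)
  have "sum_avoiders (insert x (insert y A)) k = ?F \<union> (insert x ` ?F \<union> insert y ` ?F)"
  proof (intro set_eqI iffI)
    fix S assume S: "S \<in> sum_avoiders (insert x (insert y A)) k"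
    then have "S - {x, y} \<in> ?F" by (auto simp: mem_sum_avoiders)
    moreover have "\<not> (x \<in> S \<and> y \<in> S)"
      using S assms(5) by (auto simp: mem_sum_avoiders)
    then have "S = S - {x, y} \<or> S = insert x (S - {x, y}) \<or> S = insert y (S - {x, y})"
      by blast
    ultimately show "S \<in> ?F \<union> (insert x ` ?F \<union> insert y ` ?F)"
      by (metis UnI1 UnI2 imageI)
  next
    fix S assume "S \<in> ?F \<union> (insert x ` ?F \<union> insert y ` ?F)"
    moreover have "?F \<subseteq> sum_avoiders (insert x (insert y A)) k"
      by (auto simp: mem_sum_avoiders)
    ultimately show "S \<in> sum_avoiders (insert x (insert y A)) k"
      using insert_mem by blast
  qed
  moreover have "?F \<inter> (insert x ` ?F \<union> insert y ` ?F) = {}" "insert x ` ?F \<inter> insert y ` ?F = {}"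
    using assms(2-4) unfolding mem_sum_avoiders disjoint_iff image_iff Un_iff
    by (metis insert_iff mem_sum_avoiders subsetD)+
  ultimately show ?thesis
    using assms(1-3)
    by (simp add: card_Un_disjoint finite_sum_avoiders card_image inj_on_insert_sum_avoiders)
qed

lemma card_sum_avoiders_Un_free:
  assumes "finite B" "finite A" "A \<inter> B = {}"
    and "\<And>x y. x \<in> B \<Longrightarrow> y \<in> A \<union> B \<Longrightarrow> x + y \<noteq> k"
  shows "card (sum_avoiders (A \<union> B) k) = 2 ^ card B * card (sum_avoiders A k)"
  using assms
proof (induction B rule: finite_induct)
  case (insert x B)
  have "card (sum_avoiders (insert x (A \<union> B)) k) = 2 * card (sum_avoiders (A \<union> B) k)"
    using insert by (intro card_sum_avoiders_insert_free) auto
  moreover have "card (sum_avoiders (A \<union> B) k) = 2 ^ card B * card (sum_avoiders A k)"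
    using insert by auto
  ultimately show ?case
    using insert.hyps by simp
qed simp

text \<open>The premise says that the two endpoints sum to \<open>k\<close> when
  \<open>m > 0\<close>, so the interval is symmetric under x -> k - x. Peeling off both endpoints
  preserves this relation and contributes a factor 3.\<close>

lemma card_sum_avoiders_symmetric:
  "k + 1 = 2 * a + m \<Longrightarrow> card (sum_avoiders {a..<a + m} k) = 3 ^ (m div 2)"
proof (induction m arbitrary: a rule: nat_induct2)
  case 0
  have "sum_avoiders {a..<a + 0} k = {{}}"
    by (auto simp: mem_sum_avoiders)
  then show ?case by simp
next
  case 1
  \<comment> \<open>Here \<open>k = 2 * a\<close>, so the midpoint \<open>a\<close> is its own
    partner and must be left out.\<close>
  then have "sum_avoiders {a..<a + 1} k = {{}}"
    by (fastforce simp: mem_sum_avoiders)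
  then show ?case by simp
next
  case (step m)
  have "{a..<a + (m + 2)} = insert a (insert (a + m + 1) {Suc a..<Suc a + m})"
    by auto
  moreover have "card (sum_avoiders (insert a (insert (a + m + 1) {Suc a..<Suc a + m})) k)
      = 3 * card (sum_avoiders {Suc a..<Suc a + m} k)"
    using step.prems by (intro card_sum_avoiders_insert_pair) auto
  moreover have "card (sum_avoiders {Suc a..<Suc a + m} k) = 3 ^ (m div 2)"
    using step.prems by (intro step.IH) simp
  ultimately show ?case by simp
qed

lemma card_sum_avoiders_low:
  assumes "k < n"
  shows "card (sum_avoiders {0..<n} k) = 2 ^ (n - Suc k) * 3 ^ (Suc k div 2)"
proof -
  have "card (sum_avoiders ({0..<Suc k} \<union> {Suc k..<n}) k)
      = 2 ^ card {Suc k..<n} * card (sum_avoiders {0..<Suc k} k)"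
    by (rule card_sum_avoiders_Un_free) auto
  moreover have "{0..<Suc k} \<union> {Suc k..<n} = {0..<n}"
    using assms by auto
  moreover have "card (sum_avoiders {0..<Suc k} k) = 3 ^ (Suc k div 2)"
    using card_sum_avoiders_symmetric[of k 0 "Suc k"] by simp
  ultimately show ?thesis by simp
qed

text \<open>Since \<open>n - m = k + 1 - n\<close>, an \<open>x\<close> below \<open>n - m\<close>
  would need a partner \<open>k - x \<ge> n\<close> and is free, while the top \<open>m\<close>
  elements form an interval symmetric about k/2.\<close>

lemma card_sum_avoiders_high:
  assumes "n \<le> k" "k < 2 * n - 1" and m: "m = 2 * n - 1 - k"
  shows "card (sum_avoiders {0..<n} k) = 2 ^ (n - m) * 3 ^ (m div 2)"
proof -
  have "card (sum_avoiders ({n - m..<n} \<union> {0..<n - m}) k)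
      = 2 ^ card {0..<n - m} * card (sum_avoiders {n - m..<n} k)"
    using assms by (intro card_sum_avoiders_Un_free) auto
  moreover have "{n - m..<n} \<union> {0..<n - m} = {0..<n}"
    by auto
  moreover have "card (sum_avoiders {n - m..<n - m + m} k) = 3 ^ (m div 2)"
    using assms by (intro card_sum_avoiders_symmetric) simp
  moreover have "n - m + m = n"
    using assms by simp
  ultimately show ?thesis by simp
qed

text \<open>The sum s(n) satisfies s(n+1) = 2 s(n) + 3^((n+1) div 2). A particular solution is -5 *
  3^j at n = 2j and -9 * 3^j at n = 2j + 1; s(0) = 0 then fixes the coefficient 5 of 2^n.\<close>

lemma sum_pow2_pow3:
  "(\<Sum>m = 1..n. 2 ^ (n - m) * 3 ^ (m div 2) :: int) =
    5 * 2 ^ n - (if odd n then 9 * 3 ^ (n div 2) else 5 * 3 ^ (n div 2))"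
proof (induction n)
  case (Suc n)
  have "(\<Sum>m = 1..n. 2 ^ (Suc n - m) * 3 ^ (m div 2) :: int)
      = 2 * (\<Sum>m = 1..n. 2 ^ (n - m) * 3 ^ (m div 2))"
    unfolding sum_distrib_left by (rule sum.cong) (auto simp: Suc_diff_le)
  then show ?case
    using Suc.IH by (auto elim!: oddE evenE)
qed simp

lemma sum_card_sumset_eq:
  assumes "n \<ge> 1"
  shows "(\<Sum>S\<in>Pow {0..<n}. int (card (S + S))) =
    (\<Sum>k<2 * n - 1. 2 ^ n - int (card (sum_avoiders {0..<n} k)))"
proof -
  have fin: "finite (Pow {0..<n})" by simp
  have "int (card (S + S)) = (\<Sum>k<2 * n - 1. if k \<in> S + S then 1 else 0)"
    if "S \<in> Pow {0..<n}" for S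
  proof -
    have "x + y < 2 * n - 1" if "x \<in> S" "y \<in> S" for x y
    proof -
      have "x < n" "y < n" using that \<open>S \<in> Pow {0..<n}\<close> by auto
      then show ?thesis by linarith
    qed
    then have "S + S \<subseteq> {..<2 * n - 1}"
      by (auto simp: set_plus_def)
    then have "{..<2 * n - 1} \<inter> (S + S) = S + S" by blast
    then show ?thesis by (simp add: sum.If_cases)
  qed
  then have "(\<Sum>S\<in>Pow {0..<n}. int (card (S + S))) =
      (\<Sum>S\<in>Pow {0..<n}. \<Sum>k<2 * n - 1. if k \<in> S + S then 1 else 0)"
    by (rule sum.cong[OF refl])
  also have "\<dots> = (\<Sum>k<2 * n - 1. \<Sum>S\<in>Pow {0..<n}. if k \<in> S + S then 1 else 0)"
    by (rule sum.swap)
  also have "\<dots> = (\<Sum>k<2 * n - 1. 2 ^ n - int (card (sum_avoiders {0..<n} k)))"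
  proof (rule sum.cong[OF refl])
    fix k
    have sub: "sum_avoiders {0..<n} k \<subseteq> Pow {0..<n}"
      by (auto simp: sum_avoiders_def)
    have "Pow {0..<n} \<inter> {S. k \<in> S + S} = Pow {0..<n} - sum_avoiders {0..<n} k"
      by (auto simp: sum_avoiders_def)
    then have "(\<Sum>S\<in>Pow {0..<n}. if k \<in> S + S then 1 else 0 :: int)
        = int (card (Pow {0..<n} - sum_avoiders {0..<n} k))"
      using fin by (simp add: sum.If_cases)
    also have "\<dots> = 2 ^ n - int (card (sum_avoiders {0..<n} k))"
      using card_mono[OF fin sub]
      by (simp add: card_Diff_subset finite_sum_avoiders sub card_Pow of_nat_diff)
    finally show "(\<Sum>S\<in>Pow {0..<n}. if k \<in> S + S then 1 else 0 :: int)
        = 2 ^ n - int (card (sum_avoiders {0..<n} k))" .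
  qed
  finally show ?thesis .
qed

theorem theorem17:
  fixes n :: nat
  assumes "n \<ge> 1"
  shows "(\<Sum>S\<in>Pow {0..<n}. int (card (S + S))) =
    2 ^ n * (2 * int n - 11) +
    (if odd n then 19 * 3 ^ ((n - 1) div 2) else 11 * 3 ^ (n div 2))"
proof -
  let ?c = "\<lambda>k. int (card (sum_avoiders {0..<n} k))"
  let ?w = "\<lambda>m. 2 ^ (n - m) * 3 ^ (m div 2) :: int"
  have split: "{..<2 * n - 1} = {..<n} \<union> {n..<2 * n - 1}"
    using assms by auto
  have "(\<Sum>k<2 * n - 1. ?c k) = (\<Sum>k<n. ?c k) + (\<Sum>k = n..<2 * n - 1. ?c k)"
    unfolding split by (rule sum.union_disjoint) auto
  also have "(\<Sum>k<n. ?c k) = (\<Sum>m = 1..n. ?w m)"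
    by (rule sum.reindex_bij_witness[of _ "\<lambda>m. m - 1" Suc])
      (auto simp: card_sum_avoiders_low)
  \<comment> \<open>The reflection sends n, ..., 2n - 2 onto n - 1, ..., 1, so the weight at
    \<open>m = n\<close> occurs only in the lower half; the next step subtracts it from the full
    sum.\<close>
  also have "(\<Sum>k = n..<2 * n - 1. ?c k) = (\<Sum>m = 1..<n. ?w m)"
    by (rule sum.reindex_bij_witness[of _ "\<lambda>m. 2 * n - 1 - m" "\<lambda>k. 2 * n - 1 - k"])
      (auto simp: card_sum_avoiders_high)
  also have "(\<Sum>m = 1..<n. ?w m) = (\<Sum>m = 1..n. ?w m) - 3 ^ (n div 2)"
    using assms by (simp flip: atLeastLessThanSuc_atLeastAtMost)
  finally have total: "(\<Sum>k<2 * n - 1. ?c k) = 2 * (\<Sum>m = 1..n. ?w m) - 3 ^ (n div 2)"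
    by simp
  have "(\<Sum>S\<in>Pow {0..<n}. int (card (S + S))) = (2 * int n - 1) * 2 ^ n - (\<Sum>k<2 * n - 1. ?c k)"
    using assms by (simp add: sum_card_sumset_eq sum_subtractf of_nat_diff)
  \<comment> \<open>The constants arise as (2n - 1) - 2 * 5 = 2n - 11, 2 * 9 + 1 = 19 for odd n and
    2 * 5 + 1 = 11 for even n.\<close>
  then show ?thesis
    unfolding total sum_pow2_pow3 by (auto elim!: oddE simp: algebra_simps)
qed

end
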